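(* Let $\mathbb G$ be a finitely generated group of exponential growth with a fixed finite symmetric generating set $T$, and let $\mu$ be a symmetric, non-degenerate probability measure on $\mathbb G$. Assume that there are $\beta,c,C>0$ such that $$p_{2m}(e,e)\le C\exp(-c\,m^{\beta})\qquad\text{for all large } m .$$ Then there exist a generator $t\in T$ and $\delta_0>0$ such that $$\limsup_{n\to\infty}\ \Delta\big(B(e,n);e,t\big)\ \ge\ \delta_0 .$$ In particular, along the exhausting sequence $S_n=B(e,n)$, the quantities $\Delta(S_n;e,t)$ do not converge to $0$.
   Context: Non-degenerate: $\operatorname{supp}\mu$ generates $\mathbb G$ as a semigroup; symmetric: $\mu(g)=\mu(g^{-1})$. $p_n(x,y)=\mu^{(n)}(x^{-1}y)$, where $\mu^{(n)}$ is the $n$-fold convolution power ($p_0(x,y)=\delta_{xy}$), and $G(x,y)=\sum_{n\ge0}p_n(x,y)$ is the Green function. $B(e,n)$ is the ball of radius $n$ around the identity $e$ in the word metric of $T$. For finite $S\subset\mathbb G$, $\partial S$ is the set of $x\notin S$ with $x=ys$ for some $y\in S$, $s\in T$, and $$\Delta(S;a,b):=\max_{x\in\partial S}\frac{|G(a,x)-G(b,x)|}{G(a,x)}.$$ *)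

theory Defs
  imports "HOL-Algebra.Generated_Groups" "HOL-Probability.Probability_Mass_Function"
begin

inductive_set semigroup_generate :: "('a, 'b) monoid_scheme \<Rightarrow> 'a set \<Rightarrow> 'a set"
  for G (structure) and A where
  incl: "a \<in> A \<Longrightarrow> a \<in> semigroup_generate G A"
| mult: "a \<in> semigroup_generate G A \<Longrightarrow> b \<in> semigroup_generate G A
          \<Longrightarrow> a \<otimes> b \<in> semigroup_generate G A"

definition finite_symmetric_generating_set :: "('a, 'b) monoid_scheme \<Rightarrow> 'a set \<Rightarrow> bool" where
  "finite_symmetric_generating_set G T \<longleftrightarrow>
     finite T \<and> T \<subseteq> carrier G \<and> (\<forall>t\<in>T. inv\<^bsub>G\<^esub> t \<in> T) \<and> generate G T = carrier G"

text \<open>The word length is meaningful for elements that are products of elements of \<open>T\<close>; for a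
  symmetric generating set these are all elements of the group.\<close>

definition word_length :: "('a, 'b) monoid_scheme \<Rightarrow> 'a set \<Rightarrow> 'a \<Rightarrow> nat" where
  "word_length G T x =
     (LEAST n. \<exists>ws. length ws = n \<and> set ws \<subseteq> T \<and> foldr (\<lambda>a b. a \<otimes>\<^bsub>G\<^esub> b) ws \<one>\<^bsub>G\<^esub> = x)"

definition word_dist :: "('a, 'b) monoid_scheme \<Rightarrow> 'a set \<Rightarrow> 'a \<Rightarrow> 'a \<Rightarrow> nat" where
  "word_dist G T x y = word_length G T (inv\<^bsub>G\<^esub> x \<otimes>\<^bsub>G\<^esub> y)"

definition word_ball :: "('a, 'b) monoid_scheme \<Rightarrow> 'a set \<Rightarrow> 'a \<Rightarrow> nat \<Rightarrow> 'a set" where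
  "word_ball G T x n = {y \<in> carrier G. word_dist G T x y \<le> n}"

text \<open>By submultiplicativity of the ball sizes the limit below always exists for a finite
  symmetric generating set, and whether it exceeds 1 does not depend on the choice of that set.\<close>

definition exponential_growth :: "('a, 'b) monoid_scheme \<Rightarrow> 'a set \<Rightarrow> bool" where
  "exponential_growth G T \<longleftrightarrow>
     (\<exists>L>1. (\<lambda>n. root n (real (card (word_ball G T \<one>\<^bsub>G\<^esub> n)))) \<longlonglongrightarrow> L)"

definition outer_boundary :: "('a, 'b) monoid_scheme \<Rightarrow> 'a set \<Rightarrow> 'a set \<Rightarrow> 'a set" where
  "outer_boundary G T S = {x \<in> carrier G. x \<notin> S \<and> (\<exists>y\<in>S. \<exists>s\<in>T. x = y \<otimes>\<^bsub>G\<^esub> s)}"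

text \<open>A probability measure on a finitely generated (hence countable) group is a \<open>pmf\<close> whose
  support lies in the carrier.\<close>

definition symmetric_pmf :: "('a, 'b) monoid_scheme \<Rightarrow> 'a pmf \<Rightarrow> bool" where
  "symmetric_pmf G \<mu> \<longleftrightarrow> (\<forall>g\<in>carrier G. pmf \<mu> g = pmf \<mu> (inv\<^bsub>G\<^esub> g))"

definition non_degenerate :: "('a, 'b) monoid_scheme \<Rightarrow> 'a pmf \<Rightarrow> bool" where
  "non_degenerate G \<mu> \<longleftrightarrow> semigroup_generate G (set_pmf \<mu>) = carrier G"

definition convolution_pmf :: "('a, 'b) monoid_scheme \<Rightarrow> 'a pmf \<Rightarrow> 'a pmf \<Rightarrow> 'a pmf" where
  "convolution_pmf G \<mu> \<nu> = map_pmf (\<lambda>(x, y). x \<otimes>\<^bsub>G\<^esub> y) (pair_pmf \<mu> \<nu>)"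

primrec convolution_power :: "('a, 'b) monoid_scheme \<Rightarrow> 'a pmf \<Rightarrow> nat \<Rightarrow> 'a pmf" where
  "convolution_power G \<mu> 0 = return_pmf \<one>\<^bsub>G\<^esub>"
| "convolution_power G \<mu> (Suc n) = convolution_pmf G (convolution_power G \<mu> n) \<mu>"

definition transition_prob ::
    "('a, 'b) monoid_scheme \<Rightarrow> 'a pmf \<Rightarrow> nat \<Rightarrow> 'a \<Rightarrow> 'a \<Rightarrow> real" where
  "transition_prob G \<mu> n x y = pmf (convolution_power G \<mu> n) (inv\<^bsub>G\<^esub> x \<otimes>\<^bsub>G\<^esub> y)"

text \<open>Real-valued, hence meaningful only when the series converges, i.e. for transient walks.
  For symmetric \<open>\<mu>\<close> this follows from summability of the even return probabilities.\<close>

definition green :: "('a, 'b) monoid_scheme \<Rightarrow> 'a pmf \<Rightarrow> 'a \<Rightarrow> 'a \<Rightarrow> real" where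
  "green G \<mu> x y = (\<Sum>n. transition_prob G \<mu> n x y)"

text \<open>For finite \<open>S\<close> and \<open>T\<close> the boundary is finite, so this is a genuine maximum as soon as the
  boundary is nonempty, as it is for finite nonempty \<open>S\<close> in an infinite group.\<close>

definition green_oscillation ::
    "('a, 'b) monoid_scheme \<Rightarrow> 'a set \<Rightarrow> 'a pmf \<Rightarrow> 'a set \<Rightarrow> 'a \<Rightarrow> 'a \<Rightarrow> real" where
  "green_oscillation G T \<mu> S a b =
     Max ((\<lambda>x. \<bar>green G \<mu> a x - green G \<mu> b x\<bar> / green G \<mu> a x) ` outer_boundary G T S)"

end

theory Submission
  imports Defs "HOL-Real_Asymp.Real_Asymp"
begin

text \<open>
  Write \<open>g x\<close> for \<open>G(e,x)\<close>. Two bounds on \<open>g\<close> over the balls \<open>B(e,n)\<close> contradict each other if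
  all the oscillations tend to 0.

  From above, \<open>g\<close> is square summable over the group. By symmetry the squared \<open>\<ell>\<^sup>2\<close> norm of
  the \<open>m\<close>-step distribution is the return probability \<open>p\<^sub>2\<^sub>m(e,e)\<close>, so by Minkowski's inequality
  the norm of \<open>g\<close> is at most the sum of the square roots of these return probabilities
  (\<open>L2_set_green_le\<close>), which converges under a stretched exponential bound.

  From below, suppose that \<open>\<Delta>(B(e,n);e,t) \<rightarrow> 0\<close> for every generator \<open>t\<close>. Since
  \<open>G(t,ty) = g y\<close>, this says that prepending one letter to a word spelling a far away point
  divides \<open>g\<close> by at most \<open>1 + \<epsilon>\<close>. Spelling out a point of \<open>B(e,n)\<close> letter by letter thus gives
  \<open>g \<ge> d (1 + \<epsilon>)\<^sup>-\<^sup>n\<close> on \<open>B(e,n)\<close> (\<open>green_ball_ge\<close>); non-degeneracy makes \<open>g\<close> positive, hence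
  \<open>d > 0\<close>.

  Summing the squares of the lower bound over \<open>B(e,n)\<close> shows that \<open>d\<^sup>2 |B(e,n)| (1 + \<epsilon>)\<^sup>-\<^sup>2\<^sup>n\<close>
  stays bounded. The growth is exponential, so this fails once \<open>\<epsilon>\<close> is small.
\<close>

section \<open>Convolution powers\<close>

lemma set_pmf_convolution:
  "set_pmf (convolution_pmf G \<mu> \<nu>) = (\<lambda>(x, y). x \<otimes>\<^bsub>G\<^esub> y) ` (set_pmf \<mu> \<times> set_pmf \<nu>)"
  by (simp add: convolution_pmf_def)

lemma convolution_pmf_bind:
  "convolution_pmf G \<mu> \<nu> =
     bind_pmf \<mu> (\<lambda>x. bind_pmf \<nu> (\<lambda>y. return_pmf (x \<otimes>\<^bsub>G\<^esub> y)))"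
  by (simp add: convolution_pmf_def map_pmf_def pair_pmf_def bind_assoc_pmf bind_return_pmf)

context group
begin

lemma convolution_pmf_assoc:
  assumes "set_pmf \<mu> \<subseteq> carrier G" "set_pmf \<nu> \<subseteq> carrier G" "set_pmf \<rho> \<subseteq> carrier G"
  shows "convolution_pmf G (convolution_pmf G \<mu> \<nu>) \<rho> =
         convolution_pmf G \<mu> (convolution_pmf G \<nu> \<rho>)"
  unfolding convolution_pmf_bind bind_assoc_pmf bind_return_pmf
  using assms by (intro bind_pmf_cong refl) (auto simp: m_assoc subset_iff)

lemma convolution_pmf_one_right:
  assumes "set_pmf \<mu> \<subseteq> carrier G"
  shows "convolution_pmf G \<mu> (return_pmf \<one>) = \<mu>"
proof -
  have "convolution_pmf G \<mu> (return_pmf \<one>) = bind_pmf \<mu> return_pmf"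
    unfolding convolution_pmf_bind bind_return_pmf
    using assms by (intro bind_pmf_cong refl) auto
  then show ?thesis
    by (simp add: bind_return_pmf')
qed

lemma convolution_pmf_one_left:
  assumes "set_pmf \<mu> \<subseteq> carrier G"
  shows "convolution_pmf G (return_pmf \<one>) \<mu> = \<mu>"
proof -
  have "convolution_pmf G (return_pmf \<one>) \<mu> = bind_pmf \<mu> return_pmf"
    unfolding convolution_pmf_bind bind_return_pmf
    using assms by (intro bind_pmf_cong refl) auto
  then show ?thesis
    by (simp add: bind_return_pmf')
qed

lemma set_pmf_convolution_power:
  assumes "set_pmf \<mu> \<subseteq> carrier G"
  shows "set_pmf (convolution_power G \<mu> n) \<subseteq> carrier G"
  using assms by (induction n) (auto simp: set_pmf_convolution subset_iff)

lemma convolution_power_add: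
  assumes "set_pmf \<mu> \<subseteq> carrier G"
  shows "convolution_power G \<mu> (m + n) =
         convolution_pmf G (convolution_power G \<mu> m) (convolution_power G \<mu> n)"
  using assms
  by (induction n)
     (simp_all add: convolution_pmf_one_right convolution_pmf_assoc set_pmf_convolution_power)

lemma map_inv_convolution_pmf:
  assumes "set_pmf \<mu> \<subseteq> carrier G" "set_pmf \<nu> \<subseteq> carrier G"
  shows "map_pmf (\<lambda>x. inv x) (convolution_pmf G \<mu> \<nu>) =
         convolution_pmf G (map_pmf (\<lambda>x. inv x) \<nu>) (map_pmf (\<lambda>x. inv x) \<mu>)"
proof -
  have "map_pmf (\<lambda>x. inv x) (convolution_pmf G \<mu> \<nu>) =
        bind_pmf \<mu> (\<lambda>x. bind_pmf \<nu> (\<lambda>y. return_pmf (inv y \<otimes> inv x)))"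
    unfolding convolution_pmf_bind map_pmf_def bind_assoc_pmf bind_return_pmf
    using assms by (intro bind_pmf_cong refl) (auto simp: inv_mult_group subset_iff)
  also have "\<dots> = bind_pmf \<nu> (\<lambda>y. bind_pmf \<mu> (\<lambda>x. return_pmf (inv y \<otimes> inv x)))"
    by (rule bind_commute_pmf)
  finally show ?thesis
    by (simp add: convolution_pmf_bind map_pmf_def bind_assoc_pmf bind_return_pmf)
qed

lemma map_inv_symmetric_pmf:
  assumes "set_pmf \<mu> \<subseteq> carrier G" "symmetric_pmf G \<mu>"
  shows "map_pmf (\<lambda>x. inv x) \<mu> = \<mu>"
proof (rule pmf_eqI)
  fix x
  show "pmf (map_pmf (\<lambda>x. inv x) \<mu>) x = pmf \<mu> x"
  proof (cases "x \<in> carrier G")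
    case True
    have "pmf (map_pmf (\<lambda>x. inv x) \<mu>) x = measure_pmf.prob \<mu> ((\<lambda>x. inv x) -` {x})"
      by (simp add: pmf_map)
    also have "\<dots> = measure_pmf.prob \<mu> {inv x}"
      using assms(1) True
      by (intro measure_pmf.finite_measure_eq_AE) (auto simp: AE_measure_pmf_iff subset_iff)
    also have "\<dots> = pmf \<mu> (inv x)"
      by (simp add: measure_pmf_single)
    also have "\<dots> = pmf \<mu> x"
      using assms(2) True unfolding symmetric_pmf_def by metis
    finally show ?thesis .
  next
    case False
    then have "x \<notin> set_pmf (map_pmf (\<lambda>x. inv x) \<mu>)" "x \<notin> set_pmf \<mu>"
      using assms(1) by auto
    then show ?thesis
      by (metis set_pmf_iff)
  qed
qed

text \<open>Inversion reverses the order of the factors in a convolution, which is harmless here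
  because all the factors are the same.\<close>

lemma map_inv_convolution_power:
  assumes "set_pmf \<mu> \<subseteq> carrier G" "symmetric_pmf G \<mu>"
  shows "map_pmf (\<lambda>x. inv x) (convolution_power G \<mu> n) = convolution_power G \<mu> n"
proof (induction n)
  case (Suc n)
  have "map_pmf (\<lambda>x. inv x) (convolution_power G \<mu> (Suc n)) =
        convolution_pmf G (convolution_power G \<mu> 1) (convolution_power G \<mu> n)"
    using assms Suc
    by (simp add: map_inv_convolution_pmf set_pmf_convolution_power map_inv_symmetric_pmf
        convolution_pmf_one_left)
  then show ?case
    using convolution_power_add[OF assms(1), of 1 n] by simp
qed simp

lemma pmf_convolution_power_inv:
  assumes "set_pmf \<mu> \<subseteq> carrier G" "symmetric_pmf G \<mu>" "x \<in> carrier G"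
  shows "pmf (convolution_power G \<mu> n) (inv x) = pmf (convolution_power G \<mu> n) x"
proof -
  let ?p = "convolution_power G \<mu> n"
  have "pmf ?p (inv x) = pmf (map_pmf (\<lambda>x. inv x) ?p) (inv x)"
    using assms by (simp add: map_inv_convolution_power)
  also have "\<dots> = measure_pmf.prob ?p ((\<lambda>x. inv x) -` {inv x})"
    by (simp add: pmf_map)
  also have "\<dots> = measure_pmf.prob ?p {x}"
    using assms(3) set_pmf_convolution_power[OF assms(1), of n]
    by (intro measure_pmf.finite_measure_eq_AE)
       (auto simp: AE_measure_pmf_iff subset_iff inj_on_eq_iff[OF inv_inj])
  finally show ?thesis
    by (simp add: measure_pmf_single)
qed

text \<open>Return at time \<open>2n\<close> happens in particular if the first \<open>n\<close> steps lead to some \<open>x \<in> A\<close> and the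
  product of the other \<open>n\<close> steps is \<open>x\<^sup>-\<^sup>1\<close>; by symmetry both have the same probability.\<close>

lemma L2_set_convolution_power_le:
  assumes "set_pmf \<mu> \<subseteq> carrier G" "symmetric_pmf G \<mu>" "finite A" "A \<subseteq> carrier G"
  shows "L2_set (pmf (convolution_power G \<mu> n)) A \<le> sqrt (pmf (convolution_power G \<mu> (2 * n)) \<one>)"
proof -
  let ?p = "convolution_power G \<mu> n"
  let ?I = "(\<lambda>x. (x, inv x)) ` A"
  have "(\<Sum>x\<in>A. (pmf ?p x)\<^sup>2) = (\<Sum>x\<in>A. pmf (pair_pmf ?p ?p) (x, inv x))"
    using assms by (intro sum.cong refl)
      (auto simp: pmf_pair pmf_convolution_power_inv power2_eq_square subset_iff)
  also have "\<dots> = (\<Sum>z\<in>?I. pmf (pair_pmf ?p ?p) z)"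
    by (subst sum.reindex) (auto simp: inj_on_def)
  also have "\<dots> = measure_pmf.prob (pair_pmf ?p ?p) ?I"
    using assms(3) by (simp add: measure_measure_pmf_finite)
  also have "\<dots> \<le> measure_pmf.prob (pair_pmf ?p ?p) ((\<lambda>(x, y). x \<otimes> y) -` {\<one>})"
    using assms(4) by (intro measure_pmf.finite_measure_mono) (auto simp: subset_iff)
  also have "\<dots> = pmf (convolution_pmf G ?p ?p) \<one>"
    by (simp add: convolution_pmf_def pmf_map)
  also have "\<dots> = pmf (convolution_power G \<mu> (2 * n)) \<one>"
    by (simp add: convolution_power_add[OF assms(1)] mult_2)
  finally show ?thesis
    by (simp add: L2_set_def)
qed

lemma non_degenerate_pmf_pos:
  assumes "set_pmf \<mu> \<subseteq> carrier G" "non_degenerate G \<mu>" "x \<in> carrier G"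
  obtains n where "pmf (convolution_power G \<mu> n) x > 0"
proof -
  have "x \<in> semigroup_generate G (set_pmf \<mu>)"
    using assms by (simp add: non_degenerate_def)
  then have "\<exists>n. x \<in> set_pmf (convolution_power G \<mu> n)"
  proof induction
    case (incl a)
    then have "a \<in> set_pmf (convolution_power G \<mu> 1)"
      using assms(1) by (simp add: convolution_pmf_one_left)
    then show ?case ..
  next
    case (mult a b)
    then obtain m n where
      "a \<in> set_pmf (convolution_power G \<mu> m)" "b \<in> set_pmf (convolution_power G \<mu> n)"
      by blast
    then have "a \<otimes> b \<in> set_pmf (convolution_power G \<mu> (m + n))"
      by (force simp: convolution_power_add[OF assms(1)] set_pmf_convolution)
    then show ?case ..
  qed
  then obtain n where "x \<in> set_pmf (convolution_power G \<mu> n)" ..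
  then show thesis
    by (rule that[OF pmf_positive])
qed

end

section \<open>Square summability of the Green function\<close>

lemma L2_set_sum_le: "L2_set (\<lambda>x. \<Sum>n<(N::nat). f n x) A \<le> (\<Sum>n<N. L2_set (f n) A)"
proof (induction N)
  case (Suc N)
  have "L2_set (\<lambda>x. \<Sum>n<Suc N. f n x) A \<le> L2_set (\<lambda>x. \<Sum>n<N. f n x) A + L2_set (f N) A"
    using L2_set_triangle_ineq[of "\<lambda>x. \<Sum>n<N. f n x" "f N" A] by simp
  with Suc show ?case
    by simp
qed (simp add: L2_set_def)

text \<open>Minkowski's inequality for a series of functions.\<close>

lemma L2_set_suminf_le:
  assumes "\<And>x. x \<in> A \<Longrightarrow> summable (\<lambda>n. f n x)" "summable b" "\<And>n. L2_set (f n) A \<le> b n"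
  shows "L2_set (\<lambda>x. \<Sum>n. f n x) A \<le> suminf b"
proof (rule LIMSEQ_le_const2)
  show "(\<lambda>N. L2_set (\<lambda>x. \<Sum>n<N. f n x) A) \<longlonglongrightarrow> L2_set (\<lambda>x. \<Sum>n. f n x) A"
    unfolding L2_set_def
    by (intro tendsto_real_sqrt tendsto_sum tendsto_power summable_LIMSEQ assms(1))
  have b: "0 \<le> b n" for n
    using assms(3)[of n] by (meson L2_set_nonneg order_trans)
  have "L2_set (\<lambda>x. \<Sum>n<N. f n x) A \<le> suminf b" for N
  proof -
    have "L2_set (\<lambda>x. \<Sum>n<N. f n x) A \<le> (\<Sum>n<N. b n)"
      by (rule order_trans[OF L2_set_sum_le sum_mono]) (rule assms(3))
    also have "\<dots> \<le> suminf b"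
      by (intro sum_le_suminf assms(2)) (auto intro: b)
    finally show ?thesis .
  qed
  then show "\<exists>N. \<forall>n\<ge>N. L2_set (\<lambda>x. \<Sum>k<n. f k x) A \<le> suminf b"
    by blast
qed

lemma summable_sqrt_stretched_exponential:
  fixes f :: "nat \<Rightarrow> real"
  assumes "\<beta> > 0" "c > 0" "\<And>m. f m \<ge> 0"
    and "\<forall>\<^sub>F m in sequentially. f m \<le> C * exp (- c * real m powr \<beta>)"
  shows "summable (\<lambda>m. sqrt (f m))"
proof (rule summable_comparison_test_ev)
  show "\<forall>\<^sub>F m in sequentially. norm (sqrt (f m)) \<le> sqrt (C * exp (- c * real m powr \<beta>))"
    using assms(4) by eventually_elim (use assms(3) in simp)
  have "(\<lambda>m::nat. exp (- (c / 2) * real m powr \<beta>)) \<in> O(\<lambda>m. 1 / real m ^ 2)"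
    using assms(1,2) by real_asymp
  moreover have "summable (\<lambda>m::nat. norm (1 / real m ^ 2))"
    using inverse_power_summable[of 2, where 'a = real] by (simp add: field_simps)
  ultimately have "summable (\<lambda>m::nat. exp (- (c / 2) * real m powr \<beta>))"
    by (rule summable_comparison_test_bigo[rotated])
  then have "summable (\<lambda>m::nat. sqrt C * exp (- (c / 2) * real m powr \<beta>))"
    by (rule summable_mult)
  moreover have "sqrt (C * exp (- c * real m powr \<beta>)) = sqrt C * exp (- (c / 2) * real m powr \<beta>)"
    for m :: nat
  proof -
    have "exp (- c * real m powr \<beta>) = (exp (- (c / 2) * real m powr \<beta>))\<^sup>2"
      by (simp flip: exp_of_nat_mult add: power2_eq_square exp_add[symmetric])
    then show ?thesis
      by (simp add: real_sqrt_mult)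
  qed
  ultimately show "summable (\<lambda>m. sqrt (C * exp (- c * real m powr \<beta>)))"
    by simp
qed

context group
begin

lemma green_one:
  assumes "x \<in> carrier G"
  shows "green G \<mu> \<one> x = (\<Sum>n. pmf (convolution_power G \<mu> n) x)"
  using assms by (simp add: green_def transition_prob_def)

lemma green_translate:
  assumes "t \<in> carrier G" "y \<in> carrier G"
  shows "green G \<mu> t (t \<otimes> y) = green G \<mu> \<one> y"
  using assms by (simp add: green_def transition_prob_def m_assoc[symmetric])

text \<open>The walk is transient: the \<open>\<ell>\<^sup>2\<close> bound for a single point is a pointwise one.\<close>

lemma summable_convolution_power:
  assumes "set_pmf \<mu> \<subseteq> carrier G" "symmetric_pmf G \<mu>"
    and "summable (\<lambda>n. sqrt (pmf (convolution_power G \<mu> (2 * n)) \<one>))"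
    and "x \<in> carrier G"
  shows "summable (\<lambda>n. pmf (convolution_power G \<mu> n) x)"
proof (rule summable_comparison_test'[OF assms(3)])
  fix n
  show "norm (pmf (convolution_power G \<mu> n) x) \<le> sqrt (pmf (convolution_power G \<mu> (2 * n)) \<one>)"
    using L2_set_convolution_power_le[OF assms(1,2), of "{x}" n] assms(4)
    by (simp add: L2_set_def)
qed

lemma L2_set_green_le:
  assumes "set_pmf \<mu> \<subseteq> carrier G" "symmetric_pmf G \<mu>"
    and "summable (\<lambda>n. sqrt (pmf (convolution_power G \<mu> (2 * n)) \<one>))"
    and "finite A" "A \<subseteq> carrier G"
  shows "L2_set (green G \<mu> \<one>) A \<le> (\<Sum>n. sqrt (pmf (convolution_power G \<mu> (2 * n)) \<one>))"
proof -
  have "L2_set (green G \<mu> \<one>) A = L2_set (\<lambda>x. \<Sum>n. pmf (convolution_power G \<mu> n) x) A"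
    using assms(5) by (intro L2_set_cong refl) (auto simp: green_one)
  also have "\<dots> \<le> (\<Sum>n. sqrt (pmf (convolution_power G \<mu> (2 * n)) \<one>))"
    using assms by (intro L2_set_suminf_le summable_convolution_power L2_set_convolution_power_le) auto
  finally show ?thesis .
qed

lemma green_pos:
  assumes "set_pmf \<mu> \<subseteq> carrier G" "symmetric_pmf G \<mu>" "non_degenerate G \<mu>"
    and "summable (\<lambda>n. sqrt (pmf (convolution_power G \<mu> (2 * n)) \<one>))"
    and "x \<in> carrier G"
  shows "green G \<mu> \<one> x > 0"
proof -
  obtain n where "pmf (convolution_power G \<mu> n) x > 0"
    using non_degenerate_pmf_pos assms by blast
  then show ?thesis
    unfolding green_one[OF assms(5)]
    using assms by (intro suminf_pos2[where i = n] summable_convolution_power) auto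
qed

section \<open>Words, balls and their boundaries\<close>

lemma foldr_mult_closed:
  "set ws \<subseteq> carrier G \<Longrightarrow> foldr (\<lambda>a b. a \<otimes> b) ws \<one> \<in> carrier G"
  by (induction ws) auto

lemma foldr_mult_append:
  assumes "set us \<subseteq> carrier G" "set ws \<subseteq> carrier G"
  shows "foldr (\<lambda>a b. a \<otimes> b) (us @ ws) \<one> =
         foldr (\<lambda>a b. a \<otimes> b) us \<one> \<otimes> foldr (\<lambda>a b. a \<otimes> b) ws \<one>"
  using assms
  by (induction us) (auto simp: m_assoc foldr_mult_closed simp del: foldr_append)

lemma ex_word:
  assumes "finite_symmetric_generating_set G T" "x \<in> carrier G"
  shows "\<exists>ws. set ws \<subseteq> T \<and> foldr (\<lambda>a b. a \<otimes> b) ws \<one> = x"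
proof -
  have T: "T \<subseteq> carrier G" "\<forall>t\<in>T. inv t \<in> T" and "x \<in> generate G T"
    using assms by (auto simp: finite_symmetric_generating_set_def)
  from this(3) show ?thesis
  proof induction
    case one
    show ?case
      by (intro exI[of _ "[]"]) simp
  next
    case (incl h)
    then show ?case
      using T by (intro exI[of _ "[h]"]) auto
  next
    case (inv h)
    then show ?case
      using T by (intro exI[of _ "[inv h]"]) auto
  next
    case (eng h1 h2)
    then obtain us ws where
      "set us \<subseteq> T" "foldr (\<lambda>a b. a \<otimes> b) us \<one> = h1"
      "set ws \<subseteq> T" "foldr (\<lambda>a b. a \<otimes> b) ws \<one> = h2"
      by blast
    then show ?case
      using T foldr_mult_append[of us ws] by (intro exI[of _ "us @ ws"]) auto
  qed
qed

lemma word_length_le: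
  assumes "set ws \<subseteq> T" "length ws \<le> n"
  shows "word_length G T (foldr (\<lambda>a b. a \<otimes> b) ws \<one>) \<le> n"
proof -
  have "word_length G T (foldr (\<lambda>a b. a \<otimes> b) ws \<one>) \<le> length ws"
    unfolding word_length_def by (rule Least_le) (use assms in blast)
  with assms(2) show ?thesis
    by simp
qed

lemma shortest_word:
  assumes "finite_symmetric_generating_set G T" "x \<in> carrier G"
  obtains ws where "length ws = word_length G T x" "set ws \<subseteq> T"
    "foldr (\<lambda>a b. a \<otimes> b) ws \<one> = x"
proof -
  have "\<exists>n ws. length ws = n \<and> set ws \<subseteq> T \<and> foldr (\<lambda>a b. a \<otimes> b) ws \<one> = x"
    using ex_word[OF assms] by blast
  from LeastI_ex[OF this] show thesis
    using that unfolding word_length_def by blast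
qed

lemma mem_word_ball:
  "x \<in> word_ball G T \<one> n \<longleftrightarrow> x \<in> carrier G \<and> word_length G T x \<le> n"
  by (auto simp: word_ball_def word_dist_def)

text \<open>The first letter of a geodesic word for a point of the sphere of radius \<open>n + 1\<close> splits off on
  the left, which is the side from which the oscillation moves the starting point. Membership in
  the outer boundary concerns the last letter instead, because boundaries are taken with respect
  to right multiplication.\<close>

lemma sphere_decompose:
  assumes T: "finite_symmetric_generating_set G T"
    and x: "x \<in> word_ball G T \<one> (Suc n)" "x \<notin> word_ball G T \<one> n"
  obtains t y where "t \<in> T" "y \<in> word_ball G T \<one> n" "x = t \<otimes> y"
    "x \<in> outer_boundary G T (word_ball G T \<one> n)"
proof -
  have TG: "T \<subseteq> carrier G"
    using T by (auto simp: finite_symmetric_generating_set_def)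
  have xG: "x \<in> carrier G" and len: "word_length G T x = Suc n"
    using x by (auto simp: mem_word_ball)
  from shortest_word[OF T xG] obtain ws where
    ws: "length ws = Suc n" "set ws \<subseteq> T" "foldr (\<lambda>a b. a \<otimes> b) ws \<one> = x"
    using len by metis
  have ball: "foldr (\<lambda>a b. a \<otimes> b) us \<one> \<in> word_ball G T \<one> n"
    if "length us = n" "set us \<subseteq> T" for us
    using that TG by (auto simp: mem_word_ball intro!: foldr_mult_closed word_length_le)
  obtain t us where t: "ws = t # us"
    using ws(1) by (cases ws) auto
  obtain vs s where s: "ws = vs @ [s]"
    using ws(1) by (cases ws rule: rev_cases) auto
  have "x = foldr (\<lambda>a b. a \<otimes> b) vs \<one> \<otimes> s"
    using ws TG s foldr_mult_append[of vs "[s]"] by (auto simp: subset_iff)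
  then have "x \<in> outer_boundary G T (word_ball G T \<one> n)"
    using ball[of vs] ws s x(2) xG unfolding outer_boundary_def by auto
  moreover have "x = t \<otimes> foldr (\<lambda>a b. a \<otimes> b) us \<one>" "t \<in> T"
    using ws t by auto
  ultimately show thesis
    using that ball[of us] ws t by auto
qed

lemma finite_outer_boundary:
  assumes "finite S" "finite T"
  shows "finite (outer_boundary G T S)"
proof (rule finite_subset)
  show "outer_boundary G T S \<subseteq> (\<lambda>(y, s). y \<otimes> s) ` (S \<times> T)"
    by (auto simp: outer_boundary_def)
qed (use assms in simp)

text \<open>With \<open>x = t y\<close> split as above, translation invariance turns \<open>G(t,x)\<close> into \<open>G(e,y)\<close>, so
  that the oscillation over the boundary bounds how much \<open>G(e,\<cdot>)\<close> drops from \<open>y\<close> to \<open>x\<close>.\<close>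

lemma green_step_ge:
  assumes T: "finite_symmetric_generating_set G T"
    and fin: "finite (word_ball G T \<one> n)"
    and osc: "\<And>t. t \<in> T \<Longrightarrow> green_oscillation G T \<mu> (word_ball G T \<one> n) \<one> t < \<epsilon>"
    and pos: "\<And>x. x \<in> carrier G \<Longrightarrow> green G \<mu> \<one> x > 0"
    and x: "x \<in> word_ball G T \<one> (Suc n)" "x \<notin> word_ball G T \<one> n"
  obtains y where "y \<in> word_ball G T \<one> n" "green G \<mu> \<one> y \<le> (1 + \<epsilon>) * green G \<mu> \<one> x"
proof -
  obtain t y where ty: "t \<in> T" "y \<in> word_ball G T \<one> n" "x = t \<otimes> y"
    and bd: "x \<in> outer_boundary G T (word_ball G T \<one> n)"
    using sphere_decompose[OF T x] by blast
  have "finite T" and tG: "t \<in> carrier G" and yG: "y \<in> carrier G"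
    using T ty by (auto simp: finite_symmetric_generating_set_def mem_word_ball)
  have gx: "green G \<mu> \<one> x > 0"
    using tG yG ty(3) by (intro pos) auto
  have "\<bar>green G \<mu> \<one> x - green G \<mu> t x\<bar> / green G \<mu> \<one> x
        \<le> green_oscillation G T \<mu> (word_ball G T \<one> n) \<one> t"
    unfolding green_oscillation_def
    using finite_outer_boundary[OF fin \<open>finite T\<close>] bd by (intro Max_ge) auto
  also have "\<dots> < \<epsilon>"
    using osc ty(1) by blast
  finally have "\<bar>green G \<mu> \<one> x - green G \<mu> t x\<bar> < \<epsilon> * green G \<mu> \<one> x"
    using gx by (simp add: field_simps)
  moreover have "green G \<mu> t x = green G \<mu> \<one> y"
    using green_translate tG yG ty(3) by simp
  ultimately have "green G \<mu> \<one> y \<le> (1 + \<epsilon>) * green G \<mu> \<one> x"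
    by (simp add: algebra_simps)
  with ty(2) that show thesis
    by blast
qed

text \<open>Each point outside the ball of radius \<open>N\<close> is joined to that ball by steps of the previous
  lemma; inside it, positivity and finiteness provide a lower bound.\<close>

lemma green_ball_ge:
  assumes T: "finite_symmetric_generating_set G T"
    and fin: "\<And>n. n \<ge> N \<Longrightarrow> finite (word_ball G T \<one> n)"
    and osc: "\<And>n t. n \<ge> N \<Longrightarrow> t \<in> T \<Longrightarrow>
                green_oscillation G T \<mu> (word_ball G T \<one> n) \<one> t < \<epsilon>"
    and pos: "\<And>x. x \<in> carrier G \<Longrightarrow> green G \<mu> \<one> x > 0"
    and \<epsilon>: "\<epsilon> > 0"
  obtains d where "d > 0"
    "\<And>n x. n \<ge> N \<Longrightarrow> x \<in> word_ball G T \<one> n \<Longrightarrow> d \<le> (1 + \<epsilon>) ^ n * green G \<mu> \<one> x"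
proof
  \<comment> \<open>The 1 makes the set nonempty.\<close>
  define d where "d = Min (insert 1 (green G \<mu> \<one> ` word_ball G T \<one> N))"
  have fin': "finite (insert 1 (green G \<mu> \<one> ` word_ball G T \<one> N))"
    using fin by auto
  show "d > 0"
    unfolding d_def using fin' pos by (subst Min_gr_iff) (auto simp: mem_word_ball)
  fix n x
  assume "n \<ge> N" "x \<in> word_ball G T \<one> n"
  then show "d \<le> (1 + \<epsilon>) ^ n * green G \<mu> \<one> x"
  proof (induction n arbitrary: x rule: dec_induct)
    case base
    then have "d \<le> green G \<mu> \<one> x" and "x \<in> carrier G"
      unfolding d_def using fin' by (auto intro!: Min_le simp: mem_word_ball)
    moreover have "1 * green G \<mu> \<one> x \<le> (1 + \<epsilon>) ^ N * green G \<mu> \<one> x"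
      using \<epsilon> pos[of x] \<open>x \<in> carrier G\<close> by (intro mult_right_mono one_le_power) auto
    ultimately show ?case
      by simp
  next
    case (step n)
    have "\<exists>y\<in>word_ball G T \<one> n. green G \<mu> \<one> y \<le> (1 + \<epsilon>) * green G \<mu> \<one> x"
    proof (cases "x \<in> word_ball G T \<one> n")
      case True
      then have "green G \<mu> \<one> x > 0"
        using pos by (auto simp: mem_word_ball)
      with True \<epsilon> show ?thesis
        by (intro bexI[of _ x]) (auto simp: algebra_simps)
    next
      case False
      with green_step_ge[OF T fin osc pos step.prems] step.hyps show ?thesis
        by blast
    qed
    then obtain y where y: "y \<in> word_ball G T \<one> n"
      "green G \<mu> \<one> y \<le> (1 + \<epsilon>) * green G \<mu> \<one> x" ..
    have "d \<le> (1 + \<epsilon>) ^ n * green G \<mu> \<one> y"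
      using step.IH y(1) .
    also have "\<dots> \<le> (1 + \<epsilon>) ^ n * ((1 + \<epsilon>) * green G \<mu> \<one> x)"
      using y(2) \<epsilon> by (intro mult_left_mono) auto
    finally show ?case
      by (simp add: mult_ac)
  qed
qed

end

text \<open>The third power matters: the lower bound on the Green function loses a factor \<open>r\<^sup>2\<^sup>n\<close> after
  squaring, and a factor \<open>r\<^sup>n\<close> has to survive.\<close>

lemma exponential_growth_card_gt:
  assumes "exponential_growth G T"
  obtains r where "r > 1"
    "\<forall>\<^sub>F n in sequentially. real (card (word_ball G T \<one>\<^bsub>G\<^esub> n)) > r ^ (3 * n)"
proof -
  obtain L where L: "L > 1" "(\<lambda>n. root n (real (card (word_ball G T \<one>\<^bsub>G\<^esub> n)))) \<longlonglongrightarrow> L"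
    using assms by (auto simp: exponential_growth_def)
  \<comment> \<open>Any number with \<open>1 < r\<close> and \<open>r\<^sup>3 < L\<close> would serve.\<close>
  define r where "r = root 4 L"
  have r: "r > 1" and r4: "r ^ 4 = L"
    using L(1) by (auto simp: r_def)
  have "r ^ 3 < r ^ 4"
    using r by (intro power_strict_increasing) auto
  with r4 have "\<forall>\<^sub>F n in sequentially. r ^ 3 < root n (real (card (word_ball G T \<one>\<^bsub>G\<^esub> n)))"
    using order_tendstoD(1)[OF L(2)] by simp
  moreover have "\<forall>\<^sub>F n::nat in sequentially. n > 0"
    by (rule eventually_gt_at_top)
  ultimately have "\<forall>\<^sub>F n in sequentially. real (card (word_ball G T \<one>\<^bsub>G\<^esub> n)) > r ^ (3 * n)"
  proof eventually_elim
    case (elim n)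
    then have "(r ^ 3) ^ n < root n (real (card (word_ball G T \<one>\<^bsub>G\<^esub> n))) ^ n"
      using r by (intro power_strict_mono) auto
    with elim show ?case
      by (simp add: power_mult)
  qed
  with r show thesis
    by (rule that)
qed

section \<open>Non-vanishing of the oscillation\<close>

theorem theoremD:
  fixes G :: "('a, 'b) monoid_scheme" and T :: "'a set" and \<mu> :: "'a pmf"
    and \<beta> c C :: real
  assumes "group G"
    and "finite_symmetric_generating_set G T"
    and "exponential_growth G T"
    and "set_pmf \<mu> \<subseteq> carrier G"
    and "symmetric_pmf G \<mu>"
    and "non_degenerate G \<mu>"
    and "\<beta> > 0" and "c > 0" and "C > 0"
    and "\<forall>\<^sub>F m in sequentially.
           transition_prob G \<mu> (2 * m) \<one>\<^bsub>G\<^esub> \<one>\<^bsub>G\<^esub> \<le> C * exp (- c * real m powr \<beta>)"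
  shows "\<exists>t\<in>T. \<exists>\<delta>\<^sub>0>0.
           limsup (\<lambda>n. ereal (green_oscillation G T \<mu> (word_ball G T \<one>\<^bsub>G\<^esub> n) \<one>\<^bsub>G\<^esub> t)) \<ge> ereal \<delta>\<^sub>0
         \<and> \<not> (\<lambda>n. green_oscillation G T \<mu> (word_ball G T \<one>\<^bsub>G\<^esub> n) \<one>\<^bsub>G\<^esub> t) \<longlonglongrightarrow> 0"
proof (rule ccontr)
  interpret group G by fact
  let ?B = "word_ball G T \<one>\<^bsub>G\<^esub>"
  let ?g = "green G \<mu> \<one>\<^bsub>G\<^esub>"
  let ?\<Delta> = "\<lambda>t n. green_oscillation G T \<mu> (?B n) \<one>\<^bsub>G\<^esub> t"
  assume contr: "\<not> ?thesis"
  \<comment> \<open>Failure of either half of the conclusion makes the oscillation eventually small.\<close>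
  have small: "\<forall>\<^sub>F n in sequentially. ?\<Delta> t n < \<epsilon>" if "t \<in> T" "\<epsilon> > 0" for t \<epsilon>
  proof -
    consider "limsup (\<lambda>n. ereal (?\<Delta> t n)) < ereal \<epsilon>" | "?\<Delta> t \<longlonglongrightarrow> 0"
      using contr \<open>t \<in> T\<close> \<open>\<epsilon> > 0\<close> by force
    then show ?thesis
    proof cases
      case 1
      then show ?thesis
        using Limsup_lessD by fastforce
    next
      case 2
      then show ?thesis
        using order_tendstoD(2) \<open>\<epsilon> > 0\<close> by blast
    qed
  qed
  have "finite T"
    using assms(2) by (simp add: finite_symmetric_generating_set_def)
  obtain r where r: "r > 1" and growth: "\<forall>\<^sub>F n in sequentially. real (card (?B n)) > r ^ (3 * n)"
    using exponential_growth_card_gt[OF assms(3)] by blast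
  have "\<forall>\<^sub>F n in sequentially. \<forall>t\<in>T. ?\<Delta> t n < r - 1"
    using small r \<open>finite T\<close> by (intro eventually_ball_finite) auto
  with growth have "\<forall>\<^sub>F n in sequentially.
      real (card (?B n)) > r ^ (3 * n) \<and> (\<forall>t\<in>T. ?\<Delta> t n < r - 1)"
    by (rule eventually_conj)
  then obtain N where N: "\<And>n. n \<ge> N \<Longrightarrow> real (card (?B n)) > r ^ (3 * n)"
      "\<And>n t. n \<ge> N \<Longrightarrow> t \<in> T \<Longrightarrow> ?\<Delta> t n < r - 1"
    by (auto simp: eventually_sequentially)
  \<comment> \<open>An infinite set has cardinality 0, which the growth bound excludes.\<close>
  have fin: "finite (?B n)" if "n \<ge> N" for n
  proof (rule ccontr)
    assume "infinite (?B n)"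
    with N(1)[OF that] r show False
      by (simp add: not_less)
  qed

  let ?b = "\<lambda>m. sqrt (pmf (convolution_power G \<mu> (2 * m)) \<one>\<^bsub>G\<^esub>)"
  have b: "summable ?b"
    using assms(7,8,10)
    by (intro summable_sqrt_stretched_exponential[of \<beta> c _ C]) (auto simp: transition_prob_def)
  have pos: "?g x > 0" if "x \<in> carrier G" for x
    using green_pos assms(4-6) b that by blast
  obtain d where d: "d > 0" "\<And>n x. n \<ge> N \<Longrightarrow> x \<in> ?B n \<Longrightarrow> d \<le> r ^ n * ?g x"
    using green_ball_ge[OF assms(2) fin N(2) pos] r by auto

  have bound: "d\<^sup>2 * r ^ n \<le> (suminf ?b)\<^sup>2" if n: "n \<ge> N" for n
  proof -
    have "d\<^sup>2 * r ^ (3 * n) \<le> d\<^sup>2 * real (card (?B n))"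
      using N(1)[OF n] by (intro mult_left_mono) auto
    also have "\<dots> = (\<Sum>x\<in>?B n. d\<^sup>2)"
      by simp
    also have "\<dots> \<le> (\<Sum>x\<in>?B n. (r ^ n * ?g x)\<^sup>2)"
      using d n by (intro sum_mono power_mono) auto
    also have "\<dots> = r ^ (2 * n) * (L2_set ?g (?B n))\<^sup>2"
      by (simp add: L2_set_def sum_nonneg power_mult_distrib sum_distrib_left power_even_eq)
    also have "\<dots> \<le> r ^ (2 * n) * (suminf ?b)\<^sup>2"
      using r by (intro mult_left_mono power_mono L2_set_green_le[OF assms(4,5) b fin[OF n]])
        (auto simp: mem_word_ball)
    finally have "r ^ (2 * n) * (d\<^sup>2 * r ^ n) \<le> r ^ (2 * n) * (suminf ?b)\<^sup>2"
      using power_add[of r "2 * n" n] by (simp add: mult_ac)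
    then show ?thesis
      using r by (subst (asm) mult_le_cancel_left_pos) auto
  qed
  obtain k where "(suminf ?b)\<^sup>2 / d\<^sup>2 < r ^ k"
    using real_arch_pow[OF r] by blast
  also have "\<dots> \<le> r ^ (max k N)"
    using r by (intro power_increasing) auto
  finally show False
    using bound[of "max k N"] d(1) by (simp add: field_simps)
qed

end
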